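(* Let $\mathbb K$ and $\mathbb K_\beta$ be continuous symmetric nonnegative-definite kernels on $[0,1]\times[0,1]$ with reproducing kernel Hilbert spaces (RKHS) $\mathcal H(\mathbb K)$ and $\mathcal H(\mathbb K_\beta)$. Let $\lambda, C_A, C_\beta>0$, let $0\le s_1<\cdots<s_{n_1}\le 1$ and $0\le r_1<\cdots<r_{n_2}\le 1$, and let real numbers $X_t(s_i), Y_t(r_j)$ and vectors $Z_t\in\mathbb R^p$ be given for $1\le t\le T$, $1\le i\le n_1$, $1\le j\le n_2$. Consider the problem of minimizing $$\frac{1}{Tn_2}\sum_{t=1}^T\sum_{j=1}^{n_2} w_r(j)\Big\{Y_t(r_j)-\frac1{n_1}\sum_{i=1}^{n_1}w_s(i)A(r_j,s_i)X_t(s_i)-\langle\beta(r_j),Z_t\rangle_p\Big\}^2+\lambda\sum_{l=1}^p\|\beta_l\|_{n_2}$$ over all $A\in\mathcal C_A$ and $\beta=(\beta_l)_{l=1}^p\in\mathcal C_\beta$. Then there always exists a minimizer $(\widehat A,\widehat\beta)$ of the form $$\widehat A(r,s)=\sum_{i=1}^{n_1}\sum_{j=1}^{n_2}\widehat a_{ij}\,\mathbb K(r,r_j)\,\mathbb K(s,s_i),\quad (r,s)\in[0,1]^2,\qquad \widehat\beta_l(r)=\sum_{j=1}^{n_2}\widehat b_{lj}\,\mathbb K_\beta(r_j,r),\quad r\in[0,1],\ l=1,\dots,p,$$ with $\widehat a_{ij}\in\mathbb R$ and $\widehat b_{lj}\in\mathbb R$.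
   Context: Weights: with $s_0=r_0=0$, $w_s(i)=(n_1+1)(s_i-s_{i-1})$ and $w_r(j)=(n_2+1)(r_j-r_{j-1})$. $\langle a,b\rangle_p=\sum_{i=1}^p a_ib_i$, and $\beta(r)=(\beta_1(r),\dots,\beta_p(r))$. For a function $g$ on $[0,1]$, $\|g\|_{n_2}=\sqrt{\frac1{n_2}\sum_{j=1}^{n_2}w_r(j)g^2(r_j)}$. Operators and bivariate functions: a compact linear operator $A:\mathcal H(\mathbb K)\to\mathcal H(\mathbb K)$ is identified with the bivariate function $A(r,s)=\langle A[\mathbb K(s,\cdot)],\mathbb K(r,\cdot)\rangle_{\mathcal H(\mathbb K)}$, $r,s\in[0,1]$. $\|A\|_{\mathrm F(\mathbb K)}$ is the Hilbert–Schmidt norm on $\mathcal H(\mathbb K)$: $\|A\|_{\mathrm F(\mathbb K)}^2=\sum_{i,j}\langle A[\psi_j],\psi_i\rangle_{\mathcal H(\mathbb K)}^2$ for an orthonormal basis $\{\psi_i\}$ of $\mathcal H(\mathbb K)$. Constraint sets: $\mathcal C_A=\{A:\mathcal H(\mathbb K)\to\mathcal H(\mathbb K)\text{ compact linear},\ \|A\|_{\mathrm F(\mathbb K)}^2\le C_A\}$ and $\mathcal C_\beta=\{(\beta_l)_{l=1}^p\subset\mathcal H(\mathbb K_\beta):\ \sum_{l=1}^p\|\beta_l\|_{\mathcal H(\mathbb K_\beta)}\le C_\beta\}$. *)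

theory Defs
  imports "HOL-Analysis.Analysis"
begin

definition nonneg_definite_kernel :: "'a set \<Rightarrow> ('a \<Rightarrow> 'a \<Rightarrow> real) \<Rightarrow> bool" where
  "nonneg_definite_kernel D K \<longleftrightarrow>
     (\<forall>(n::nat) x c. (\<forall>i<n. x i \<in> D) \<longrightarrow> (\<Sum>i<n. \<Sum>j<n. c i * c j * K (x i) (x j)) \<ge> 0)"

definition symmetric_kernel :: "'a set \<Rightarrow> ('a \<Rightarrow> 'a \<Rightarrow> real) \<Rightarrow> bool" where
  "symmetric_kernel D K \<longleftrightarrow> (\<forall>x\<in>D. \<forall>y\<in>D. K x y = K y x)"

text \<open>
  The RKHS of a kernel \<open>K\<close> on \<open>D\<close> is a Hilbert type \<open>'h\<close> together with the map \<open>ev\<close> sending an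
  element to the function it stands for.  Linearity and injectivity of \<open>f \<mapsto> ev f\<close> on \<open>D\<close> say that
  \<open>'h\<close> is a Hilbert space of functions on \<open>D\<close>; the last clause says that it contains \<open>K(x, \<cdot>)\<close> and
  that inner products with \<open>K(x, \<cdot>)\<close> evaluate at \<open>x\<close>.  Values of \<open>ev f\<close> outside \<open>D\<close> are
  irrelevant.
\<close>

definition is_rkhs ::
  "'a set \<Rightarrow> ('a \<Rightarrow> 'a \<Rightarrow> real) \<Rightarrow> ('h::{real_inner,complete_space} \<Rightarrow> 'a \<Rightarrow> real) \<Rightarrow> bool" where
  "is_rkhs D K ev \<longleftrightarrow>
     (\<forall>x\<in>D. linear (\<lambda>f. ev f x)) \<and>
     (\<forall>f g. (\<forall>x\<in>D. ev f x = ev g x) \<longrightarrow> f = g) \<and>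
     (\<forall>x\<in>D. \<exists>k. (\<forall>y\<in>D. ev k y = K x y) \<and> (\<forall>f. f \<bullet> k = ev f x))"

text \<open>The element \<open>K(x, \<cdot>)\<close>, unique by injectivity of \<open>ev\<close> on \<open>D\<close>.\<close>

definition kernel_section ::
  "'a set \<Rightarrow> ('a \<Rightarrow> 'a \<Rightarrow> real) \<Rightarrow> ('h::{real_inner,complete_space} \<Rightarrow> 'a \<Rightarrow> real) \<Rightarrow> 'a \<Rightarrow> 'h" where
  "kernel_section D K ev x = (THE k. \<forall>y\<in>D. ev k y = K x y)"

definition bivariate ::
  "'a set \<Rightarrow> ('a \<Rightarrow> 'a \<Rightarrow> real) \<Rightarrow> ('h::{real_inner,complete_space} \<Rightarrow> 'a \<Rightarrow> real) \<Rightarrow> ('h \<Rightarrow> 'h)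
     \<Rightarrow> 'a \<Rightarrow> 'a \<Rightarrow> real" where
  "bivariate D K ev A r s = A (kernel_section D K ev s) \<bullet> kernel_section D K ev r"

definition compact_operator :: "('h::real_normed_vector \<Rightarrow> 'h) \<Rightarrow> bool" where
  "compact_operator A \<longleftrightarrow> linear A \<and> (\<forall>S. bounded S \<longrightarrow> compact (closure (A ` S)))"

definition orthonormal_basis :: "'h::real_inner set \<Rightarrow> bool" where
  "orthonormal_basis B \<longleftrightarrow>
     pairwise orthogonal B \<and> (\<forall>b\<in>B. norm b = 1) \<and> closure (span B) = UNIV"

text \<open>
  The squared Hilbert--Schmidt norm.  Every complete inner product space has an orthonormal basis
  and the value does not depend on the one chosen.  The sum is taken in \<open>ennreal\<close>, so that it is
  infinite for an operator that is not Hilbert--Schmidt.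
\<close>

definition hs_norm_sq :: "('h::{real_inner,complete_space} \<Rightarrow> 'h) \<Rightarrow> ennreal" where
  "hs_norm_sq A =
     (let B = (SOME B. orthonormal_basis B)
      in \<Sum>\<^sub>\<infinity>(e, f)\<in>B \<times> B. ennreal ((A f \<bullet> e)\<^sup>2))"

definition constraint_A :: "real \<Rightarrow> ('h::{real_inner,complete_space} \<Rightarrow> 'h) set" where
  "constraint_A C = {A. compact_operator A \<and> hs_norm_sq A \<le> ennreal C}"

definition constraint_beta :: "real \<Rightarrow> ('p::finite \<Rightarrow> 'g::real_normed_vector) set" where
  "constraint_beta C = {\<beta>. (\<Sum>l\<in>UNIV. norm (\<beta> l)) \<le> C}"

definition weight :: "nat \<Rightarrow> (nat \<Rightarrow> real) \<Rightarrow> nat \<Rightarrow> real" where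
  "weight n x i = (real n + 1) * (x i - x (i - 1))"

definition empirical_norm :: "nat \<Rightarrow> (nat \<Rightarrow> real) \<Rightarrow> (real \<Rightarrow> real) \<Rightarrow> real" where
  "empirical_norm n x g = sqrt (1 / real n * (\<Sum>j=1..n. weight n x j * (g (x j))\<^sup>2))"

end

theory Submission
  imports Defs
begin

text \<open>
  The data enter the objective only through finitely many numbers: the values
  \<open>A(r\<^sub>j, s\<^sub>i) = \<langle>A k\<^sub>s\<^sub>i, k\<^sub>r\<^sub>j\<rangle>\<close> of the operator, where \<open>k\<^sub>x\<close> is the kernel section at \<open>x\<close>, and the
  values \<open>\<beta>\<^sub>l(r\<^sub>j) = \<langle>\<beta>\<^sub>l, k\<^sub>r\<^sub>j\<rangle>\<close> of the coefficient functions.  In these numbers the objective is a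
  polynomial plus square roots, hence continuous.  It therefore suffices to show that every vector
  of values reached by a feasible point is also reached by a feasible point of the required form,
  and that the vectors reached by the points of that form make up a compact set.

  For the coefficient functions this is the usual representer argument.  Projecting \<open>\<beta>\<^sub>l\<close> onto the
  span of the \<open>k\<^sub>r\<^sub>j\<close> keeps its inner products with them and does not increase its norm, and a
  bounded closed subset of a finite-dimensional span is compact (\<open>vector_values_compact\<close>).

  For the operator, let \<open>U\<close> and \<open>V\<close> be orthonormal bases of the spans of the \<open>k\<^sub>r\<^sub>j\<close> and of the
  \<open>k\<^sub>s\<^sub>i\<close>, and replace \<open>A\<close> by the compression to these spans, which is the finite-rank operator with
  the matrix \<open>c(u, v) = \<langle>A v, u\<rangle>\<close>.  This keeps the values (\<open>operator_values_compact\<close>).  It remains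
  feasible because its squared Hilbert--Schmidt norm is at most \<open>\<Sum> c(u, v)\<^sup>2\<close>
  (\<open>hs_norm_sq_finite_rank_operator_le\<close>), which in turn is at most that of \<open>A\<close>
  (\<open>orthonormal_entries_le_hs_norm_sq\<close>).  Both bounds come from one inequality for a change between
  finite orthonormal systems (\<open>orthonormal_coordinate_change\<close>): applied from \<open>U\<close> and \<open>V\<close> to finite
  parts of the basis that defines the norm it gives the first bound, applied in the opposite
  direction, followed by a limit along growing parts of that basis, it gives the second.  Both
  uses rest on the existence of an orthonormal basis (\<open>orthonormal_basis_exists\<close>); this follows
  from Zorn's lemma and the fact that, in a complete space, a subspace that is not dense has a
  nonzero vector orthogonal to it.
\<close>

section \<open>Finite orthonormal systems\<close>

definition orthonormal :: "'a::real_inner set \<Rightarrow> bool" where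
  "orthonormal U \<longleftrightarrow> pairwise orthogonal U \<and> (\<forall>u\<in>U. norm u = 1)"

lemma orthonormal_inner:
  assumes "orthonormal U" "u \<in> U" "v \<in> U"
  shows "u \<bullet> v = (if u = v then 1 else 0)"
  using assms by (auto simp: orthonormal_def pairwise_def orthogonal_def norm_eq_1)

lemma orthonormal_subset: "orthonormal U \<Longrightarrow> V \<subseteq> U \<Longrightarrow> orthonormal V"
  by (auto simp: orthonormal_def intro: pairwise_subset)

lemma inner_sum_orthonormal:
  assumes "orthonormal U" "finite U" "u \<in> U"
  shows "(\<Sum>v\<in>U. a v *\<^sub>R v) \<bullet> u = a u"
proof -
  have "(\<Sum>v\<in>U. a v *\<^sub>R v) \<bullet> u = (\<Sum>v\<in>U. if v = u then a v else 0)"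
    unfolding inner_sum_left using assms by (intro sum.cong) (auto simp: orthonormal_inner)
  then show ?thesis using assms by simp
qed

lemma norm_sum_orthonormal:
  assumes "orthonormal U" "finite U"
  shows "(norm (\<Sum>v\<in>U. a v *\<^sub>R v))\<^sup>2 = (\<Sum>v\<in>U. (a v)\<^sup>2)"
proof -
  have "(norm (\<Sum>v\<in>U. a v *\<^sub>R v))\<^sup>2 = (\<Sum>u\<in>U. a u * ((\<Sum>v\<in>U. a v *\<^sub>R v) \<bullet> u))"
    by (simp add: power2_norm_eq_inner inner_sum_right)
  also have "\<dots> = (\<Sum>v\<in>U. (a v)\<^sup>2)"
    using assms by (intro sum.cong) (auto simp: inner_sum_orthonormal power2_eq_square)
  finally show ?thesis .
qed

text \<open>
  Completing the square: the error of approximating \<open>x\<close> by a combination of \<open>U\<close> splits into the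
  unavoidable part and the squared distance of the coefficients from the Fourier coefficients.
  Bessel's inequality and the best-approximation property are read off from it.
\<close>

lemma norm_diff_orthonormal_sum:
  assumes "orthonormal U" "finite U"
  shows "(norm (x - (\<Sum>u\<in>U. a u *\<^sub>R u)))\<^sup>2
      = (norm x)\<^sup>2 - (\<Sum>u\<in>U. (x \<bullet> u)\<^sup>2) + (\<Sum>u\<in>U. (x \<bullet> u - a u)\<^sup>2)"
proof -
  have "(norm (x - (\<Sum>u\<in>U. a u *\<^sub>R u)))\<^sup>2
      = (norm x)\<^sup>2 - 2 * (x \<bullet> (\<Sum>u\<in>U. a u *\<^sub>R u)) + (norm (\<Sum>u\<in>U. a u *\<^sub>R u))\<^sup>2"
    by (simp add: power2_norm_eq_inner inner_diff_left inner_diff_right inner_commute)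
  also have "\<dots> = (norm x)\<^sup>2 - 2 * (\<Sum>u\<in>U. a u * (x \<bullet> u)) + (\<Sum>u\<in>U. (a u)\<^sup>2)"
    using norm_sum_orthonormal[OF assms] by (simp add: inner_sum_right)
  finally show ?thesis
    by (simp add: power2_diff sum.distrib sum_subtractf sum_distrib_left algebra_simps)
qed

lemma bessel_inequality:
  assumes "orthonormal U" "finite U"
  shows "(\<Sum>u\<in>U. (x \<bullet> u)\<^sup>2) \<le> (norm x)\<^sup>2"
proof -
  have "0 \<le> (norm (x - (\<Sum>u\<in>U. (x \<bullet> u) *\<^sub>R u)))\<^sup>2" by simp
  then show ?thesis unfolding norm_diff_orthonormal_sum[OF assms] by simp
qed

lemma orthonormal_projection_best:
  assumes "orthonormal U" "finite U" and y: "y \<in> span U"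
  shows "norm (x - (\<Sum>u\<in>U. (x \<bullet> u) *\<^sub>R u)) \<le> norm (x - y)"
proof -
  from y obtain a where "y = (\<Sum>u\<in>U. a u *\<^sub>R u)"
    using assms(2) by (auto simp: span_finite)
  then have "(norm (x - (\<Sum>u\<in>U. (x \<bullet> u) *\<^sub>R u)))\<^sup>2 \<le> (norm (x - y))\<^sup>2"
    by (simp add: norm_diff_orthonormal_sum[OF assms(1,2)] sum_nonneg)
  then show ?thesis by (simp add: power2_le_iff_abs_le)
qed

lemma orthonormal_expansion:
  assumes "orthonormal U" "finite U" "x \<in> span U"
  shows "x = (\<Sum>u\<in>U. (x \<bullet> u) *\<^sub>R u)"
  using orthonormal_projection_best[OF assms, of x] by simp

lemma inner_orthonormal_expansion:
  assumes "orthonormal U" "finite U" "x \<in> span U"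
  shows "y \<bullet> x = (\<Sum>u\<in>U. (y \<bullet> u) * (u \<bullet> x))"
  by (subst orthonormal_expansion[OF assms]) (simp add: inner_sum_right inner_commute mult.commute)

lemma orthonormal_basis_of_finite_span:
  fixes S :: "'a::real_inner set"
  assumes "finite S"
  obtains U where "finite U" "orthonormal U" "span U = span S"
proof -
  obtain C where C: "finite C" "span C = span S" "pairwise orthogonal C"
    using basis_orthogonal[OF assms] by auto
  define U where "U = (\<lambda>x. x /\<^sub>R norm x) ` (C - {0})"
  have "orthonormal U"
    using C(3) by (auto simp: orthonormal_def U_def pairwise_def orthogonal_def)
  moreover have "span U = span S"
  proof -
    have "span U \<subseteq> span C"
      by (rule span_minimal) (auto simp: U_def intro: span_scale span_base)
    moreover have "x \<in> span U" if "x \<in> C" for x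
    proof (cases "x = 0")
      case False
      then have "norm x *\<^sub>R (x /\<^sub>R norm x) \<in> span U"
        using that by (intro span_scale span_base) (auto simp: U_def)
      then show ?thesis using False by simp
    qed (simp add: span_zero)
    then have "span C \<subseteq> span U" by (intro span_minimal) auto
    ultimately show ?thesis using C(2) by simp
  qed
  moreover have "finite U" using C(1) by (simp add: U_def)
  ultimately show ?thesis using that by blast
qed

text \<open>
  A matrix \<open>c\<close> stands for the tensor \<open>\<Sum> c(u, v) u \<otimes> v\<close>, of squared norm \<open>\<Sum> c(u, v)\<^sup>2\<close>.  The
  numbers squared on the left are its coefficients against the orthonormal tensors \<open>e \<otimes> f\<close>, so this
  is Bessel's inequality in the tensor product.  In coordinates, it is Bessel's inequality
  for \<open>F\<close> and then for \<open>E\<close>.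
\<close>

lemma orthonormal_coordinate_change:
  fixes E :: "'a::real_inner set" and F :: "'b::real_inner set"
  assumes E: "orthonormal E" "finite E" and F: "orthonormal F" "finite F"
    and U: "orthonormal U" "finite U" and V: "orthonormal V" "finite V"
  shows "(\<Sum>e\<in>E. \<Sum>f\<in>F. (\<Sum>u\<in>U. \<Sum>v\<in>V. c u v * (u \<bullet> e) * (v \<bullet> f))\<^sup>2)
       \<le> (\<Sum>u\<in>U. \<Sum>v\<in>V. (c u v)\<^sup>2)"
proof -
  define w where "w e = (\<Sum>v\<in>V. (\<Sum>u\<in>U. c u v * (u \<bullet> e)) *\<^sub>R v)" for e
  define z where "z v = (\<Sum>u\<in>U. c u v *\<^sub>R u)" for v
  have "(\<Sum>u\<in>U. \<Sum>v\<in>V. c u v * (u \<bullet> e) * (v \<bullet> f)) = w e \<bullet> f" for e f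
    unfolding w_def inner_sum_left inner_scaleR_left sum_distrib_right
    by (rule sum.swap)
  then have "(\<Sum>e\<in>E. \<Sum>f\<in>F. (\<Sum>u\<in>U. \<Sum>v\<in>V. c u v * (u \<bullet> e) * (v \<bullet> f))\<^sup>2)
      = (\<Sum>e\<in>E. \<Sum>f\<in>F. (w e \<bullet> f)\<^sup>2)" by simp
  also have "\<dots> \<le> (\<Sum>e\<in>E. (norm (w e))\<^sup>2)"
    by (intro sum_mono bessel_inequality F)
  also have "\<dots> = (\<Sum>e\<in>E. \<Sum>v\<in>V. (z v \<bullet> e)\<^sup>2)"
    by (simp add: w_def z_def norm_sum_orthonormal[OF V] inner_sum_left)
  also have "\<dots> = (\<Sum>v\<in>V. \<Sum>e\<in>E. (z v \<bullet> e)\<^sup>2)" by (rule sum.swap)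
  also have "\<dots> \<le> (\<Sum>v\<in>V. (norm (z v))\<^sup>2)"
    by (intro sum_mono bessel_inequality E)
  also have "\<dots> = (\<Sum>v\<in>V. \<Sum>u\<in>U. (c u v)\<^sup>2)"
    by (simp add: z_def norm_sum_orthonormal[OF U])
  also have "\<dots> = (\<Sum>u\<in>U. \<Sum>v\<in>V. (c u v)\<^sup>2)" by (rule sum.swap)
  finally show ?thesis .
qed

section \<open>Orthonormal bases of Hilbert spaces\<close>

text \<open>
  The vector is \<open>x - l\<close>, where \<open>l\<close> is the nearest point to \<open>x\<close> in the closure.  Completeness is
  needed for \<open>l\<close> to exist as the limit of almost nearest points.
\<close>

lemma orthogonal_vector_to_nondense_subspace:
  fixes S :: "'a::{real_inner,complete_space} set"
  assumes S: "subspace S" and x: "x \<notin> closure S"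
  obtains z where "z \<noteq> 0" "\<And>y. y \<in> S \<Longrightarrow> z \<bullet> y = 0"
proof -
  define D where "D = (INF y\<in>S. (norm (x - y))\<^sup>2)"
  have S0: "0 \<in> S" using S by (rule subspace_0)
  have bdd: "bdd_below ((\<lambda>y. (norm (x - y))\<^sup>2) ` S)" by (rule bdd_belowI2[of _ 0]) simp
  have D_le: "D \<le> (norm (x - y))\<^sup>2" if "y \<in> S" for y
    unfolding D_def by (rule cINF_lower[OF bdd that])
  have "\<exists>y\<in>S. (norm (x - y))\<^sup>2 < D + inverse (real (Suc n))" for n
  proof -
    have "Inf ((\<lambda>y. (norm (x - y))\<^sup>2) ` S) < D + inverse (real (Suc n))"
      by (simp add: D_def)
    from cInf_lessD[OF _ this] S0 show ?thesis by blast
  qed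
  then obtain y where yS: "\<And>n. y n \<in> S"
    and y: "\<And>n. (norm (x - y n))\<^sup>2 < D + inverse (real (Suc n))" by metis
  \<comment> \<open>The midpoint of two almost nearest points lies in the subspace, so by the parallelogram law
    the two points are close to each other.\<close>
  have close: "(norm (y m - y n))\<^sup>2 < 2 * inverse (real (Suc m)) + 2 * inverse (real (Suc n))" for m n
  proof -
    have "(1/2) *\<^sub>R (y m + y n) \<in> S"
      by (intro subspace_scale subspace_add S yS)
    then have "D \<le> (norm (x - (1/2) *\<^sub>R (y m + y n)))\<^sup>2" by (rule D_le)
    moreover have "(norm (y m - y n))\<^sup>2
        = 2 * (norm (x - y m))\<^sup>2 + 2 * (norm (x - y n))\<^sup>2 - 4 * (norm (x - (1/2) *\<^sub>R (y m + y n)))\<^sup>2"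
      by (simp add: power2_norm_eq_inner inner_diff_left inner_diff_right inner_add_left
          inner_add_right inner_commute algebra_simps)
    ultimately show ?thesis using y[of m] y[of n] by linarith
  qed
  have "Cauchy y"
  proof (rule CauchyI)
    fix e :: real assume "e > 0"
    then obtain N where N: "inverse (real (Suc N)) < e\<^sup>2 / 4"
      using reals_Archimedean[of "e\<^sup>2 / 4"] by auto
    have "norm (y m - y n) < e" if "m \<ge> N" "n \<ge> N" for m n
    proof -
      have "inverse (real (Suc m)) \<le> inverse (real (Suc N))"
        "inverse (real (Suc n)) \<le> inverse (real (Suc N))" using that by auto
      then have "(norm (y m - y n))\<^sup>2 < e\<^sup>2" using close[of m n] N by linarith
      then show ?thesis using \<open>e > 0\<close> by (simp add: power_less_imp_less_base)
    qed
    then show "\<exists>N. \<forall>m\<ge>N. \<forall>n\<ge>N. norm (y m - y n) < e" by blast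
  qed
  then obtain l where l: "y \<longlonglongrightarrow> l" using Cauchy_convergent_iff convergent_def by blast
  define z where "z = x - l"
  have "l \<in> closure S" using l yS closure_sequential by blast
  then have "z \<noteq> 0" using x by (auto simp: z_def)
  have z_le: "(norm z)\<^sup>2 \<le> D"
  proof (rule LIMSEQ_le)
    show "(\<lambda>n. (norm (x - y n))\<^sup>2) \<longlonglongrightarrow> (norm z)\<^sup>2"
      unfolding z_def by (intro tendsto_intros l)
    show "(\<lambda>n. D + inverse (real (Suc n))) \<longlonglongrightarrow> D"
      using tendsto_add[OF tendsto_const LIMSEQ_inverse_real_of_nat, of D] by simp
  qed (use y less_imp_le in blast)
  have "z \<bullet> v = 0" if v: "v \<in> S" for v
  proof (cases "v = 0")
    case False
    \<comment> \<open>Moving from the nearest point by the component of \<open>z\<close> along \<open>v\<close> would bring it strictly closer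
      to \<open>x\<close>, unless that component vanishes.\<close>
    define t where "t = (z \<bullet> v) / (v \<bullet> v)"
    have "D \<le> (norm (z - t *\<^sub>R v))\<^sup>2"
    proof (rule LIMSEQ_le_const)
      show "(\<lambda>n. (norm (x - (y n + t *\<^sub>R v)))\<^sup>2) \<longlonglongrightarrow> (norm (z - t *\<^sub>R v))\<^sup>2"
        unfolding z_def diff_diff_eq by (intro tendsto_intros l)
      show "\<exists>N. \<forall>n\<ge>N. D \<le> (norm (x - (y n + t *\<^sub>R v)))\<^sup>2"
        using v by (auto intro!: D_le subspace_add subspace_scale S yS)
    qed
    also have "(norm (z - t *\<^sub>R v))\<^sup>2 = (norm z)\<^sup>2 - 2 * t * (z \<bullet> v) + t\<^sup>2 * (v \<bullet> v)"
      unfolding power2_norm_eq_inner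
      by (simp add: inner_diff_left inner_diff_right inner_commute power2_eq_square algebra_simps)
    also have "\<dots> = (norm z)\<^sup>2 - (z \<bullet> v)\<^sup>2 / (v \<bullet> v)"
      using False by (simp add: t_def power2_eq_square)
    finally have "(z \<bullet> v)\<^sup>2 / (v \<bullet> v) \<le> 0" using z_le by linarith
    moreover have "0 < v \<bullet> v" using False by simp
    ultimately show ?thesis by (simp add: divide_le_0_iff)
  qed simp
  with \<open>z \<noteq> 0\<close> show ?thesis using that by blast
qed

text \<open>
  A maximal orthonormal set has a dense span, since otherwise it could be extended by a normalized
  orthogonal vector.
\<close>

lemma orthonormal_basis_exists: "\<exists>B::'a::{real_inner,complete_space} set. orthonormal_basis B"
proof -
  have "\<exists>B\<in>Collect orthonormal. \<forall>C\<in>Collect orthonormal. B \<subseteq> C \<longrightarrow> C = (B::'a set)"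
  proof (rule subset_Zorn_nonempty)
    show "Collect orthonormal \<noteq> ({}::'a set set)"
      by (auto simp: orthonormal_def intro!: exI[of _ "{}"])
    fix \<C> :: "'a set set" assume ch: "subset.chain (Collect orthonormal) \<C>"
    then have on: "\<And>C. C \<in> \<C> \<Longrightarrow> orthonormal C" by (auto simp: subset_chain_def)
    have "orthogonal u v" if uv: "C \<in> \<C>" "u \<in> C" "D \<in> \<C>" "v \<in> D" "u \<noteq> v" for u v C D
    proof -
      have "C \<subseteq> D \<or> D \<subseteq> C" using ch uv unfolding subset_chain_def by blast
      then have "\<exists>M\<in>\<C>. u \<in> M \<and> v \<in> M" using uv by blast
      then show ?thesis using on uv(5) by (auto simp: orthonormal_def pairwise_def)
    qed
    then show "\<Union>\<C> \<in> Collect orthonormal"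
      using on by (auto simp: orthonormal_def pairwise_def)
  qed
  then obtain B :: "'a set" where B: "orthonormal B"
    and max: "\<And>C. orthonormal C \<Longrightarrow> B \<subseteq> C \<Longrightarrow> C = B" by auto
  have "x \<in> closure (span B)" for x
  proof (rule ccontr)
    assume "x \<notin> closure (span B)"
    then obtain z where z: "z \<noteq> 0" "\<And>y. y \<in> span B \<Longrightarrow> z \<bullet> y = 0"
      using orthogonal_vector_to_nondense_subspace[OF subspace_span] by metis
    define b where "b = z /\<^sub>R norm z"
    have b: "norm b = 1" "\<And>y. y \<in> span B \<Longrightarrow> b \<bullet> y = 0"
      using z by (auto simp: b_def)
    then have "orthonormal (insert b B)"
      using B by (auto simp: orthonormal_def pairwise_insert orthogonal_def inner_commute span_base)
    then have "b \<in> B" using max by blast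
    then have "b \<bullet> b = 0" using b(2) span_base by blast
    with b(1) show False by simp
  qed
  then show ?thesis using B by (auto simp: orthonormal_basis_def orthonormal_def)
qed

lemma orthonormal_basis_imp_orthonormal: "orthonormal_basis B \<Longrightarrow> orthonormal B"
  by (simp add: orthonormal_basis_def orthonormal_def)

text \<open>
  One sequence of finite parts of the basis serves all vectors of a finite set at once, so that
  finite sums of expressions in these vectors can be passed to the limit together.  A sequence
  suffices even if the basis is uncountable.
\<close>

lemma orthonormal_basis_projections_tendsto:
  fixes B :: "'a::real_inner set"
  assumes B: "orthonormal_basis B" and W: "finite W"
  obtains F where "\<And>n. finite (F n)" "\<And>n::nat. F n \<subseteq> B"
    "\<And>x. x \<in> W \<Longrightarrow> (\<lambda>n. \<Sum>b\<in>F n. (x \<bullet> b) *\<^sub>R b) \<longlonglongrightarrow> x"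
proof -
  have on: "orthonormal B" using B by (rule orthonormal_basis_imp_orthonormal)
  have "\<exists>F. finite F \<and> F \<subseteq> B \<and> (\<forall>x\<in>W. norm (x - (\<Sum>b\<in>F. (x \<bullet> b) *\<^sub>R b)) < inverse (real (Suc n)))"
    for n
  proof -
    have "\<exists>G. finite G \<and> G \<subseteq> B \<and> (\<exists>y\<in>span G. norm (x - y) < inverse (real (Suc n)))" for x
    proof -
      have "x \<in> closure (span B)" using B by (simp add: orthonormal_basis_def)
      then obtain y where "y \<in> span B" "norm (x - y) < inverse (real (Suc n))"
        unfolding closure_approachable dist_norm norm_minus_commute[of _ x] using inverse_Suc by blast
      moreover from this(1) obtain G a where "finite G" "G \<subseteq> B" "y = (\<Sum>b\<in>G. a b *\<^sub>R b)"
        unfolding span_explicit by blast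
      moreover have "(\<Sum>b\<in>G. a b *\<^sub>R b) \<in> span G" by (intro span_sum span_scale span_base)
      ultimately show ?thesis by blast
    qed
    then obtain G where G: "\<And>x. finite (G x)" "\<And>x. G x \<subseteq> B"
      "\<And>x. \<exists>y\<in>span (G x). norm (x - y) < inverse (real (Suc n))" by metis
    \<comment> \<open>Enlarging the finite set can only improve the best approximation.\<close>
    define F where "F = (\<Union>x\<in>W. G x)"
    have F: "finite F" "F \<subseteq> B" using G W by (auto simp: F_def)
    have "norm (x - (\<Sum>b\<in>F. (x \<bullet> b) *\<^sub>R b)) < inverse (real (Suc n))" if x: "x \<in> W" for x
    proof -
      obtain y where y: "y \<in> span (G x)" "norm (x - y) < inverse (real (Suc n))"
        using G(3) by blast
      have "y \<in> span F" using y(1) x span_mono[of "G x" F] by (auto simp: F_def)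
      from orthonormal_projection_best[OF orthonormal_subset[OF on F(2)] F(1) this, of x] y(2)
      show ?thesis by linarith
    qed
    with F show ?thesis by blast
  qed
  then obtain F where F: "\<And>n. finite (F n)" "\<And>n. F n \<subseteq> B"
    and near: "\<And>n x. x \<in> W \<Longrightarrow> norm (x - (\<Sum>b\<in>F n. (x \<bullet> b) *\<^sub>R b)) < inverse (real (Suc n))"
    by metis
  have "(\<lambda>n. \<Sum>b\<in>F n. (x \<bullet> b) *\<^sub>R b) \<longlonglongrightarrow> x" if x: "x \<in> W" for x
  proof (rule LIM_zero_cancel, rule Lim_null_comparison)
    show "\<forall>\<^sub>F n in sequentially. norm ((\<Sum>b\<in>F n. (x \<bullet> b) *\<^sub>R b) - x) \<le> inverse (real (Suc n))"
      using near[OF x] by (intro always_eventually) (simp add: norm_minus_commute less_imp_le)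
  qed (rule LIMSEQ_inverse_real_of_nat)
  with F that show ?thesis by blast
qed

section \<open>Compact sets of coefficients\<close>

text \<open>
  Coefficients are functions on the whole index type, forced to be zero off \<open>I\<close>: Tychonoff's theorem
  then applies to the function type with its product topology.
\<close>

lemma compact_coefficient_box:
  "compact {c::'i \<Rightarrow> real. (\<forall>i\<in>I. \<bar>c i\<bar> \<le> M) \<and> (\<forall>i. i \<notin> I \<longrightarrow> c i = 0)}"
proof -
  let ?S = "\<lambda>i. if i \<in> I then {-M..M} else {0}"
  have "compactin (product_topology (\<lambda>i. euclidean) UNIV) (PiE UNIV ?S)"
    unfolding compactin_PiE by auto
  then have "compact (PiE UNIV ?S)"
    unfolding euclidean_product_topology compactin_euclidean_iff .
  moreover have "PiE UNIV ?S = {c. (\<forall>i\<in>I. \<bar>c i\<bar> \<le> M) \<and> (\<forall>i. i \<notin> I \<longrightarrow> c i = 0)}"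
    by (auto simp: PiE_UNIV_domain Pi_iff abs_le_iff split: if_splits) (smt (verit))+
  ultimately show ?thesis by simp
qed

lemma continuous_on_coordinate: "continuous_on S (\<lambda>c. c i :: 'b::topological_space)"
  by (rule continuous_on_subset[OF continuous_on_product_coordinates subset_UNIV])

lemma compact_bounded_coefficients:
  fixes g :: "('i \<Rightarrow> real) \<Rightarrow> real"
  assumes g: "continuous_on UNIV g"
    and bound: "\<And>c i. g c \<le> C \<Longrightarrow> i \<in> I \<Longrightarrow> \<bar>c i\<bar> \<le> M"
  shows "compact {c. g c \<le> C \<and> (\<forall>i. i \<notin> I \<longrightarrow> c i = 0)}"
proof -
  have "closed {c. g c \<le> C}"
    by (intro closed_Collect_le g continuous_intros)
  moreover have "{c. g c \<le> C \<and> (\<forall>i. i \<notin> I \<longrightarrow> c i = 0)}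
      = {c. g c \<le> C} \<inter> {c. (\<forall>i\<in>I. \<bar>c i\<bar> \<le> M) \<and> (\<forall>i. i \<notin> I \<longrightarrow> c i = 0)}"
    using bound by auto
  ultimately show ?thesis
    using closed_Int_compact[OF _ compact_coefficient_box] by simp
qed

section \<open>Finite-rank operators and the Hilbert--Schmidt norm\<close>

definition finite_rank_operator ::
  "'a::real_inner set \<Rightarrow> 'a set \<Rightarrow> ('a \<times> 'a \<Rightarrow> real) \<Rightarrow> 'a \<Rightarrow> 'a" where
  "finite_rank_operator U V c x = (\<Sum>u\<in>U. (\<Sum>v\<in>V. c (u, v) * (v \<bullet> x)) *\<^sub>R u)"

lemma inner_finite_rank_operator:
  "finite_rank_operator U V c x \<bullet> y = (\<Sum>u\<in>U. \<Sum>v\<in>V. c (u, v) * (u \<bullet> y) * (v \<bullet> x))"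
  unfolding finite_rank_operator_def inner_sum_left inner_scaleR_left sum_distrib_right
  by (simp add: mult_ac)

text \<open>
  The coefficients of the image of a bounded set are bounded by Cauchy--Schwarz, so the image lies
  in a continuous image of a compact box of coefficients.
\<close>

lemma compact_operator_finite_rank_operator:
  assumes "finite U"
  shows "compact_operator (finite_rank_operator U V c)"
  unfolding compact_operator_def
proof (intro conjI allI impI)
  show "linear (finite_rank_operator U V c)"
    by (rule linearI) (simp_all add: finite_rank_operator_def inner_add_right algebra_simps
        sum.distrib scaleR_sum_right sum_distrib_left)
  fix S :: "'a set" assume "bounded S"
  then obtain b where b: "\<And>x. x \<in> S \<Longrightarrow> norm x \<le> b" by (auto simp: bounded_iff)
  define M where "M = (\<Sum>u\<in>U. \<Sum>v\<in>V. \<bar>c (u, v)\<bar> * (norm v * b))"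
  let ?box = "{a. (\<forall>u\<in>U. \<bar>a u\<bar> \<le> M) \<and> (\<forall>u. u \<notin> U \<longrightarrow> a u = 0)}"
  let ?K = "(\<lambda>a. \<Sum>u\<in>U. a u *\<^sub>R u) ` ?box"
  have K: "compact ?K"
    by (intro compact_continuous_image compact_coefficient_box continuous_intros
        continuous_on_coordinate)
  have "finite_rank_operator U V c x \<in> ?K" if x: "x \<in> S" for x
  proof -
    let ?a = "\<lambda>u. if u \<in> U then \<Sum>v\<in>V. c (u, v) * (v \<bullet> x) else 0"
    have b0: "0 \<le> b" using b[OF x] norm_ge_zero order_trans by blast
    have "\<bar>?a u\<bar> \<le> M" if u: "u \<in> U" for u
    proof -
      have "\<bar>?a u\<bar> \<le> (\<Sum>v\<in>V. \<bar>c (u, v) * (v \<bullet> x)\<bar>)" using u by simp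
      also have "\<dots> \<le> (\<Sum>v\<in>V. \<bar>c (u, v)\<bar> * (norm v * b))"
        unfolding abs_mult
        by (intro sum_mono mult_left_mono order_trans[OF Cauchy_Schwarz_ineq2] b x) auto
      also have "\<dots> \<le> M" unfolding M_def
        by (rule member_le_sum[OF u]) (auto intro!: sum_nonneg mult_nonneg_nonneg b0 assms)
      finally show ?thesis .
    qed
    then have "?a \<in> ?box" by simp
    moreover have "finite_rank_operator U V c x = (\<Sum>u\<in>U. ?a u *\<^sub>R u)"
      by (simp add: finite_rank_operator_def)
    ultimately show ?thesis by - (rule rev_image_eqI)
  qed
  then have "closure (finite_rank_operator U V c ` S) \<subseteq> ?K"
    by (intro closure_minimal compact_imp_closed K) auto
  then have "?K \<inter> closure (finite_rank_operator U V c ` S) = closure (finite_rank_operator U V c ` S)"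
    by (rule Int_absorb1)
  with compact_Int_closed[OF K closed_closure[of "finite_rank_operator U V c ` S"]]
  show "compact (closure (finite_rank_operator U V c ` S))" by (simp only:)
qed

lemma compact_operator_bounded_linear:
  assumes "compact_operator A"
  shows "bounded_linear A"
proof -
  have lin: "linear A" using assms by (simp add: compact_operator_def)
  have "compact (closure (A ` cball 0 1))" using assms by (simp add: compact_operator_def)
  then have "bounded (A ` cball 0 1)"
    by (rule bounded_subset[OF compact_imp_bounded closure_subset])
  then obtain b where "\<forall>y\<in>A ` cball 0 1. norm y \<le> b"
    unfolding bounded_iff by blast
  then have b: "norm (A x) \<le> b" if "norm x \<le> 1" for x
    using that by simp
  show ?thesis
  proof (rule bounded_linear_intro[where K = b])
    fix x :: 'a
    show "norm (A x) \<le> norm x * b"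
    proof (cases "x = 0")
      case False
      have "norm (A x) = norm x * norm (A (x /\<^sub>R norm x))"
        using False by (simp add: linear_cmul[OF lin])
      also have "\<dots> \<le> norm x * b" using False by (intro mult_left_mono b) auto
      finally show ?thesis .
    qed (simp add: linear_0[OF lin])
  qed (simp_all add: linear_add[OF lin] linear_cmul[OF lin])
qed

text \<open>
  Every finite partial sum of the series that defines the Hilbert--Schmidt norm is covered by a
  finite rectangle of basis pairs, and \<open>orthonormal_coordinate_change\<close> bounds the sum over it.
\<close>

lemma hs_norm_sq_finite_rank_operator_le:
  fixes U V :: "'a::{real_inner,complete_space} set"
  assumes U: "orthonormal U" "finite U" and V: "orthonormal V" "finite V"
  shows "hs_norm_sq (finite_rank_operator U V c) \<le> ennreal (\<Sum>u\<in>U. \<Sum>v\<in>V. (c (u, v))\<^sup>2)"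
proof -
  define B where "B = (SOME B::'a set. orthonormal_basis B)"
  have B: "orthonormal B"
    unfolding B_def by (intro orthonormal_basis_imp_orthonormal someI_ex[OF orthonormal_basis_exists])
  let ?h = "\<lambda>(e, f). (finite_rank_operator U V c f \<bullet> e)\<^sup>2"
  have "(\<Sum>\<^sub>\<infinity>p\<in>B \<times> B. ennreal (?h p)) \<le> ennreal (\<Sum>u\<in>U. \<Sum>v\<in>V. (c (u, v))\<^sup>2)"
  proof (rule infsum_le_finite_sums)
    fix P assume P: "finite P" "P \<subseteq> B \<times> B"
    have E: "orthonormal (fst ` P)" "orthonormal (snd ` P)"
      using P(2) by (auto intro!: orthonormal_subset[OF B])
    have "sum ?h P \<le> sum ?h (fst ` P \<times> snd ` P)"
      using P(1) by (intro sum_mono2) (auto simp: rev_image_eqI)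
    also have "\<dots> = (\<Sum>e\<in>fst ` P. \<Sum>f\<in>snd ` P. (finite_rank_operator U V c f \<bullet> e)\<^sup>2)"
      by (rule sum.cartesian_product[symmetric])
    also have "\<dots> \<le> (\<Sum>u\<in>U. \<Sum>v\<in>V. (c (u, v))\<^sup>2)"
      unfolding inner_finite_rank_operator
      by (rule orthonormal_coordinate_change) (use E P(1) U V in auto)
    finally show "(\<Sum>p\<in>P. ennreal (?h p)) \<le> ennreal (\<Sum>u\<in>U. \<Sum>v\<in>V. (c (u, v))\<^sup>2)"
      by (subst sum_ennreal) (auto intro: ennreal_leI)
  qed (simp add: nonneg_summable_on_complete)
  then show ?thesis
    unfolding hs_norm_sq_def Let_def B_def by (simp add: case_prod_unfold)
qed

text \<open>
  For \<open>u\<close> and \<open>v\<close> in the span of finitely many basis vectors this is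
  \<open>orthonormal_coordinate_change\<close> applied to the matrix of \<open>A\<close> in the basis.  The general case
  follows by continuity of \<open>A\<close>, after replacing each \<open>u\<close> and \<open>v\<close> by its projections onto growing
  finite parts of the basis.
\<close>

lemma orthonormal_entries_le_hs_norm_sq:
  fixes A :: "'a::{real_inner,complete_space} \<Rightarrow> 'a"
  assumes A: "compact_operator A" and hs: "hs_norm_sq A \<le> ennreal C" and C: "0 \<le> C"
    and U: "orthonormal U" "finite U" and V: "orthonormal V" "finite V"
  shows "(\<Sum>u\<in>U. \<Sum>v\<in>V. (A v \<bullet> u)\<^sup>2) \<le> C"
proof -
  interpret A: bounded_linear A using A by (rule compact_operator_bounded_linear)
  define B where "B = (SOME B::'a set. orthonormal_basis B)"
  have B: "orthonormal_basis B"
    unfolding B_def by (rule someI_ex[OF orthonormal_basis_exists])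
  have partial: "(\<Sum>e\<in>F. \<Sum>f\<in>F. (A f \<bullet> e)\<^sup>2) \<le> C" if F: "finite F" "F \<subseteq> B" for F
  proof -
    let ?h = "\<lambda>(e, f). (A f \<bullet> e)\<^sup>2"
    have "ennreal (sum ?h (F \<times> F)) = (\<Sum>p\<in>F \<times> F. ennreal (?h p))"
      by (subst sum_ennreal) auto
    also have "\<dots> \<le> (\<Sum>\<^sub>\<infinity>p\<in>B \<times> B. ennreal (?h p))"
      using F by (subst nonneg_infsum_complete) (auto intro!: SUP_upper)
    also have "\<dots> \<le> ennreal C"
      using hs unfolding hs_norm_sq_def Let_def B_def by (simp add: case_prod_unfold)
    finally show ?thesis using C by (simp add: sum.cartesian_product)
  qed
  obtain F where F: "\<And>n. finite (F n)" "\<And>n::nat. F n \<subseteq> B"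
    and lim: "\<And>x. x \<in> U \<union> V \<Longrightarrow> (\<lambda>n. \<Sum>b\<in>F n. (x \<bullet> b) *\<^sub>R b) \<longlonglongrightarrow> x"
    using orthonormal_basis_projections_tendsto[OF B, of "U \<union> V"] U V by blast
  define P where "P n x = (\<Sum>b\<in>F n. (x \<bullet> b) *\<^sub>R b)" for n x
  show ?thesis
  proof (rule LIMSEQ_le_const2)
    show "(\<lambda>n. \<Sum>u\<in>U. \<Sum>v\<in>V. (A (P n v) \<bullet> P n u)\<^sup>2) \<longlonglongrightarrow> (\<Sum>u\<in>U. \<Sum>v\<in>V. (A v \<bullet> u)\<^sup>2)"
      unfolding P_def by (intro tendsto_intros A.tendsto lim) auto
    have "(\<Sum>u\<in>U. \<Sum>v\<in>V. (A (P n v) \<bullet> P n u)\<^sup>2) \<le> C" for n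
    proof -
      have "A (P n v) \<bullet> P n u = (\<Sum>e\<in>F n. \<Sum>f\<in>F n. (A f \<bullet> e) * (e \<bullet> u) * (f \<bullet> v))" for u v
        unfolding P_def A.sum A.scaleR inner_sum_right inner_sum_left inner_scaleR_left
          inner_scaleR_right sum_distrib_left by (simp add: inner_commute mult_ac)
      then have "(\<Sum>u\<in>U. \<Sum>v\<in>V. (A (P n v) \<bullet> P n u)\<^sup>2)
          = (\<Sum>u\<in>U. \<Sum>v\<in>V. (\<Sum>e\<in>F n. \<Sum>f\<in>F n. (A f \<bullet> e) * (e \<bullet> u) * (f \<bullet> v))\<^sup>2)" by simp
      also have "\<dots> \<le> (\<Sum>e\<in>F n. \<Sum>f\<in>F n. (A f \<bullet> e)\<^sup>2)"
        by (intro orthonormal_coordinate_change U V F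
            orthonormal_subset[OF orthonormal_basis_imp_orthonormal[OF B] F(2)])
      also have "\<dots> \<le> C" by (rule partial[OF F])
      finally show ?thesis .
    qed
    then show "\<exists>N. \<forall>n\<ge>N. (\<Sum>u\<in>U. \<Sum>v\<in>V. (A (P n v) \<bullet> P n u)\<^sup>2) \<le> C" by blast
  qed
qed

section \<open>Attainable values\<close>

text \<open>
  Compressing a feasible operator to the spans of \<open>R\<close> and \<open>S\<close> keeps it feasible and keeps the
  values \<open>\<langle>A q, p\<rangle>\<close> with \<open>p \<in> R\<close> and \<open>q \<in> S\<close>.  The compressed operators are parametrized
  continuously by matrices in a closed ball, whence compactness.  Values at other pairs are set to
  \<open>0\<close>, because the original operator and its compression may differ there.
\<close>

lemma operator_values_compact:
  fixes R S :: "'a::{real_inner,complete_space} set"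
  assumes "finite R" "finite S" and C: "0 \<le> C"
  defines "val \<equiv> \<lambda>A (p, q). if p \<in> R \<and> q \<in> S then A q \<bullet> p else 0"
  obtains U V where "finite U" "U \<subseteq> span R" "finite V" "V \<subseteq> span S"
    "compact (val ` (constraint_A C \<inter> range (finite_rank_operator U V)))"
    "val ` constraint_A C \<subseteq> val ` (constraint_A C \<inter> range (finite_rank_operator U V))"
proof -
  obtain U where U: "finite U" "orthonormal U" "span U = span R"
    using orthonormal_basis_of_finite_span[OF assms(1)] .
  obtain V where V: "finite V" "orthonormal V" "span V = span S"
    using orthonormal_basis_of_finite_span[OF assms(2)] .
  let ?op = "finite_rank_operator U V"
  let ?g = "\<lambda>c :: 'a \<times> 'a \<Rightarrow> real. \<Sum>u\<in>U. \<Sum>v\<in>V. (c (u, v))\<^sup>2"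
  let ?\<Theta> = "{c. ?g c \<le> C \<and> (\<forall>p. p \<notin> U \<times> V \<longrightarrow> c p = 0)}"
  have "compact ?\<Theta>"
  proof (rule compact_bounded_coefficients)
    show "continuous_on UNIV ?g"
      by (intro continuous_intros continuous_on_coordinate)
    fix c :: "'a \<times> 'a \<Rightarrow> real" and p assume gc: "?g c \<le> C" and p: "p \<in> U \<times> V"
    have "(c p)\<^sup>2 \<le> (\<Sum>p\<in>U \<times> V. (c p)\<^sup>2)" using p U V by (intro member_le_sum) auto
    also have "\<dots> \<le> C" using gc by (simp add: sum.cartesian_product)
    finally show "\<bar>c p\<bar> \<le> sqrt C" using real_sqrt_le_mono by fastforce
  qed
  moreover have "continuous_on ?\<Theta> (\<lambda>c. val (?op c))"
  proof (rule continuous_on_coordinatewise_then_product)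
    fix p :: "'a \<times> 'a"
    show "continuous_on ?\<Theta> (\<lambda>c. val (?op c) p)"
    proof (cases p)
      case (Pair x y)
      show ?thesis
        unfolding Pair val_def case_prod_conv inner_finite_rank_operator
        by (cases "x \<in> R \<and> y \<in> S"; simp only: simp_thms if_True if_False)
          (intro continuous_intros continuous_on_coordinate)+
    qed
  qed
  ultimately have comp: "compact ((\<lambda>c. val (?op c)) ` ?\<Theta>)"
    by (rule compact_continuous_image[rotated])
  have feasible: "?op c \<in> constraint_A C" if "?g c \<le> C" for c
    using order_trans[OF hs_norm_sq_finite_rank_operator_le[OF U(2,1) V(2,1)] ennreal_leI[OF that]]
    by (simp add: constraint_A_def compact_operator_finite_rank_operator U(1))
  have all: "val A \<in> (\<lambda>c. val (?op c)) ` ?\<Theta>" if A: "A \<in> constraint_A C" for A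
  proof -
    let ?c = "\<lambda>(u, v). if u \<in> U \<and> v \<in> V then A v \<bullet> u else 0"
    interpret A: bounded_linear A
      using A by (intro compact_operator_bounded_linear) (simp add: constraint_A_def)
    have "?g ?c = (\<Sum>u\<in>U. \<Sum>v\<in>V. (A v \<bullet> u)\<^sup>2)" by (intro sum.cong) auto
    also have "\<dots> \<le> C"
      using A by (intro orthonormal_entries_le_hs_norm_sq C U V) (auto simp: constraint_A_def)
    finally have "?c \<in> ?\<Theta>" by auto
    moreover have "?op ?c q \<bullet> p = A q \<bullet> p" if pq: "p \<in> R" "q \<in> S" for p q
    proof -
      have p: "p \<in> span U" and q: "q \<in> span V" using pq U V by (auto intro: span_base)
      have "A q \<bullet> p = (\<Sum>v\<in>V. (q \<bullet> v) * (A v \<bullet> p))"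
        by (subst orthonormal_expansion[OF V(2,1) q])
          (simp add: A.sum A.scaleR inner_sum_left)
      also have "\<dots> = (\<Sum>v\<in>V. (q \<bullet> v) * (\<Sum>u\<in>U. (A v \<bullet> u) * (u \<bullet> p)))"
        by (intro sum.cong refl arg_cong2[where f = "(*)"] inner_orthonormal_expansion U p)
      also have "\<dots> = (\<Sum>v\<in>V. \<Sum>u\<in>U. (A v \<bullet> u) * (u \<bullet> p) * (v \<bullet> q))"
        unfolding sum_distrib_left by (simp add: inner_commute mult_ac)
      also have "\<dots> = (\<Sum>u\<in>U. \<Sum>v\<in>V. (A v \<bullet> u) * (u \<bullet> p) * (v \<bullet> q))" by (rule sum.swap)
      also have "\<dots> = ?op ?c q \<bullet> p"
        unfolding inner_finite_rank_operator by (intro sum.cong) auto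
      finally show ?thesis by simp
    qed
    then have "val A = val (?op ?c)" by (auto simp: val_def fun_eq_iff)
    ultimately show ?thesis by blast
  qed
  have eq: "(\<lambda>c. val (?op c)) ` ?\<Theta> = val ` (constraint_A C \<inter> range ?op)"
    using all feasible by blast
  show ?thesis
  proof (rule that)
    show "U \<subseteq> span R" "V \<subseteq> span S" using U V span_superset by metis+
  qed (use U(1) V(1) comp all eq in auto)
qed

text \<open>
  The analogue for coefficient vectors: orthogonal projection onto the span of \<open>R\<close> does not increase
  norms and keeps the inner products with \<open>R\<close>.
\<close>

lemma vector_values_compact:
  fixes R :: "'a::real_inner set" and C :: real
  assumes "finite R"
  defines "val \<equiv> \<lambda>(\<beta>::'p::finite \<Rightarrow> 'a) (l, p). if p \<in> R then \<beta> l \<bullet> p else 0"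
    and "\<B> \<equiv> constraint_beta C \<inter> {\<beta>. \<forall>l. \<beta> l \<in> span R}"
  shows "compact (val ` \<B>)" and "val ` constraint_beta C \<subseteq> val ` \<B>"
proof -
  obtain W where W: "finite W" "orthonormal W" "span W = span R"
    using orthonormal_basis_of_finite_span[OF assms(1)] .
  let ?b = "\<lambda>(d :: 'p \<times> 'a \<Rightarrow> real) l. \<Sum>w\<in>W. d (l, w) *\<^sub>R w"
  let ?g = "\<lambda>d. \<Sum>l\<in>UNIV. norm (?b d l)"
  let ?\<Theta> = "{d. ?g d \<le> C \<and> (\<forall>p. p \<notin> (UNIV::'p set) \<times> W \<longrightarrow> d p = 0)}"
  have "compact ?\<Theta>"
  proof (rule compact_bounded_coefficients)
    show "continuous_on UNIV ?g"
      by (intro continuous_intros continuous_on_coordinate)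
    fix d :: "'p \<times> 'a \<Rightarrow> real" and p :: "'p \<times> 'a" assume gd: "?g d \<le> C" and p: "p \<in> UNIV \<times> W"
    obtain l w where lw: "p = (l, w)" "w \<in> W" using p by auto
    have "\<bar>d (l, w)\<bar> = \<bar>?b d l \<bullet> w\<bar>"
      using inner_sum_orthonormal[OF W(2,1) lw(2), of "\<lambda>w. d (l, w)"] by simp
    also have "\<dots> \<le> norm (?b d l)"
      using Cauchy_Schwarz_ineq2[of "?b d l" w] W(2) lw(2) by (simp add: orthonormal_def)
    also have "\<dots> \<le> ?g d" by (rule member_le_sum) auto
    finally show "\<bar>d p\<bar> \<le> C" using gd lw by simp
  qed
  moreover have "continuous_on ?\<Theta> (\<lambda>d. val (?b d))"
  proof (rule continuous_on_coordinatewise_then_product)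
    fix p :: "'p \<times> 'a"
    show "continuous_on ?\<Theta> (\<lambda>d. val (?b d) p)"
    proof (cases p)
      case (Pair l x)
      show ?thesis
        unfolding Pair val_def case_prod_conv
        by (cases "x \<in> R") (auto intro!: continuous_intros continuous_on_coordinate)
    qed
  qed
  ultimately have comp: "compact ((\<lambda>d. val (?b d)) ` ?\<Theta>)"
    by (rule compact_continuous_image[rotated])
  have "?b d l \<in> span R" for d l
    unfolding W(3)[symmetric] by (intro span_sum span_scale span_base)
  then have feasible: "?b d \<in> \<B>" if "?g d \<le> C" for d
    using that by (simp add: \<B>_def constraint_beta_def)
  have all: "val \<beta> \<in> (\<lambda>d. val (?b d)) ` ?\<Theta>" if \<beta>: "\<beta> \<in> constraint_beta C" for \<beta>
  proof -
    let ?d = "\<lambda>(l, w). if w \<in> W then \<beta> l \<bullet> w else 0"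
    have d: "?b ?d l = (\<Sum>w\<in>W. (\<beta> l \<bullet> w) *\<^sub>R w)" for l by (intro sum.cong) auto
    have "norm (?b ?d l) \<le> norm (\<beta> l)" for l
    proof (rule power2_le_imp_le)
      show "(norm (?b ?d l))\<^sup>2 \<le> (norm (\<beta> l))\<^sup>2"
        unfolding d norm_sum_orthonormal[OF W(2,1)] by (rule bessel_inequality[OF W(2,1)])
    qed simp
    then have "?g ?d \<le> (\<Sum>l\<in>UNIV. norm (\<beta> l))" by (intro sum_mono)
    also have "\<dots> \<le> C" using \<beta> by (simp add: constraint_beta_def)
    finally have "?d \<in> ?\<Theta>" by auto
    moreover have "?b ?d l \<bullet> x = \<beta> l \<bullet> x" if "x \<in> R" for l x
    proof -
      have x: "x \<in> span W" using that W by (auto intro: span_base)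
      show ?thesis
        unfolding d inner_orthonormal_expansion[OF W(2,1) x, of "\<beta> l"] by (simp add: inner_sum_left)
    qed
    then have "val \<beta> = val (?b ?d)" by (auto simp: val_def fun_eq_iff)
    ultimately show ?thesis by blast
  qed
  have "\<B> \<subseteq> constraint_beta C" by (auto simp: \<B>_def)
  then have eq: "(\<lambda>d. val (?b d)) ` ?\<Theta> = val ` \<B>"
    using all feasible by blast
  show "compact (val ` \<B>)" using comp eq by simp
  show "val ` constraint_beta C \<subseteq> val ` \<B>" using all eq by auto
qed

section \<open>Kernel sections and expansions in spans\<close>

lemma kernel_section_reproducing:
  fixes ev :: "'h::{real_inner,complete_space} \<Rightarrow> 'a \<Rightarrow> real"
  assumes "is_rkhs D K ev" and "x \<in> D"
  shows "\<And>y. y \<in> D \<Longrightarrow> ev (kernel_section D K ev x) y = K x y"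
    and "f \<bullet> kernel_section D K ev x = ev f x"
proof -
  obtain k where k: "\<forall>y\<in>D. ev k y = K x y" "\<forall>f. f \<bullet> k = ev f x"
    using assms unfolding is_rkhs_def by blast
  have "kernel_section D K ev x = k"
    unfolding kernel_section_def
  proof (rule the_equality[where P = "\<lambda>k. \<forall>y\<in>D. ev k y = K x y", OF k(1)])
    fix k' assume "\<forall>y\<in>D. ev k' y = K x y"
    then have "\<forall>y\<in>D. ev k' y = ev k y" using k(1) by simp
    then show "k' = k" using assms(1) unfolding is_rkhs_def by blast
  qed
  with k show "\<And>y. y \<in> D \<Longrightarrow> ev (kernel_section D K ev x) y = K x y"
    and "f \<bullet> kernel_section D K ev x = ev f x" by auto
qed

lemma inner_kernel_sections:
  assumes "is_rkhs D K ev" "x \<in> D" "y \<in> D"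
  shows "kernel_section D K ev x \<bullet> kernel_section D K ev y = K x y"
  using kernel_section_reproducing[OF assms(1)] assms(2,3) by metis

text \<open>
  The coefficients are indexed by \<open>J\<close> and not by the vectors, since different sample points may have
  the same kernel section.
\<close>

lemma span_image_coefficients:
  assumes J: "finite J" and x: "x \<in> span (g ` J)"
  obtains a where "x = (\<Sum>j\<in>J. a j *\<^sub>R g j)"
proof -
  let ?L = "range (\<lambda>a. \<Sum>j\<in>J. a j *\<^sub>R g j)"
  have "subspace ?L"
  proof (rule subspaceI)
    show "0 \<in> ?L" by (rule range_eqI[of _ _ "\<lambda>_. 0"]) simp
    fix x y assume "x \<in> ?L" "y \<in> ?L"
    then obtain a b where ab: "x = (\<Sum>j\<in>J. a j *\<^sub>R g j)" "y = (\<Sum>j\<in>J. b j *\<^sub>R g j)" by auto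
    show "x + y \<in> ?L"
      by (rule range_eqI[of _ _ "\<lambda>j. a j + b j"]) (simp add: ab scaleR_add_left sum.distrib)
  next
    fix c x assume "x \<in> ?L"
    then obtain a where a: "x = (\<Sum>j\<in>J. a j *\<^sub>R g j)" by auto
    show "c *\<^sub>R x \<in> ?L"
      by (rule range_eqI[of _ _ "\<lambda>j. c * a j"]) (simp add: a scaleR_sum_right)
  qed
  moreover have "g ` J \<subseteq> ?L"
  proof (rule image_subsetI)
    fix i assume i: "i \<in> J"
    have "g i = (\<Sum>j\<in>J. if j = i then g j else 0)" using i J by simp
    also have "\<dots> = (\<Sum>j\<in>J. (if j = i then 1 else 0) *\<^sub>R g j)"
      by (intro sum.cong) auto
    finally have eq: "g i = (\<Sum>j\<in>J. (if j = i then 1 else 0) *\<^sub>R g j)" .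
    show "g i \<in> ?L"
      by (rule range_eqI[where x = "\<lambda>j. if j = i then 1 else 0"]) (rule eq)
  qed
  ultimately have "span (g ` J) \<subseteq> ?L" by (intro span_minimal)
  then show ?thesis using x that by blast
qed

lemma sum_swap_outer:
  "(\<Sum>u\<in>U. \<Sum>v\<in>V. \<Sum>i\<in>I. g u v i) = (\<Sum>i\<in>I. \<Sum>u\<in>U. \<Sum>v\<in>V. g u v i)"
  by (rule trans[OF sum.cong[OF refl sum.swap] sum.swap])

text \<open>
  Expanding both families in the generators of their spans turns the matrix in \<open>U\<close> and
  \<open>V\<close> into coefficients for the pairs of generators.  When the generators are kernel sections, the
  right-hand side is the required form of the bivariate function.
\<close>

lemma finite_rank_operator_kernel_form:
  assumes I: "finite I" "V \<subseteq> span (q ` I)" and J: "finite J" "U \<subseteq> span (p ` J)"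
  obtains a where "\<And>x y. finite_rank_operator U V c y \<bullet> x
    = (\<Sum>i\<in>I. \<Sum>j\<in>J. a i j * (p j \<bullet> x) * (q i \<bullet> y))"
proof -
  have "\<forall>u\<in>U. \<exists>\<alpha>. u = (\<Sum>j\<in>J. \<alpha> j *\<^sub>R p j)"
    using J span_image_coefficients[OF J(1)] by (metis subsetD)
  then obtain \<alpha> where \<alpha>: "\<And>u. u \<in> U \<Longrightarrow> u = (\<Sum>j\<in>J. \<alpha> u j *\<^sub>R p j)" by metis
  have "\<forall>v\<in>V. \<exists>\<gamma>. v = (\<Sum>i\<in>I. \<gamma> i *\<^sub>R q i)"
    using I span_image_coefficients[OF I(1)] by (metis subsetD)
  then obtain \<gamma> where \<gamma>: "\<And>v. v \<in> V \<Longrightarrow> v = (\<Sum>i\<in>I. \<gamma> v i *\<^sub>R q i)" by metis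
  let ?t = "\<lambda>x y u v i j. c (u, v) * \<alpha> u j * \<gamma> v i * (p j \<bullet> x) * (q i \<bullet> y)"
  have "finite_rank_operator U V c y \<bullet> x
    = (\<Sum>i\<in>I. \<Sum>j\<in>J. (\<Sum>u\<in>U. \<Sum>v\<in>V. c (u, v) * \<alpha> u j * \<gamma> v i) * (p j \<bullet> x) * (q i \<bullet> y))" for x y
  proof -
    have summand: "c (u, v) * (u \<bullet> x) * (v \<bullet> y) = (\<Sum>i\<in>I. \<Sum>j\<in>J. ?t x y u v i j)"
      if "u \<in> U" "v \<in> V" for u v
    proof -
      have "u \<bullet> x = (\<Sum>j\<in>J. \<alpha> u j * (p j \<bullet> x))"
        by (subst \<alpha>[OF that(1)]) (simp add: inner_sum_left)
      moreover have "v \<bullet> y = (\<Sum>i\<in>I. \<gamma> v i * (q i \<bullet> y))"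
        by (subst \<gamma>[OF that(2)]) (simp add: inner_sum_left)
      ultimately have "c (u, v) * (u \<bullet> x) * (v \<bullet> y)
          = c (u, v) * ((\<Sum>i\<in>I. \<gamma> v i * (q i \<bullet> y)) * (\<Sum>j\<in>J. \<alpha> u j * (p j \<bullet> x)))"
        by (simp only: mult_ac)
      also have "\<dots> = (\<Sum>i\<in>I. \<Sum>j\<in>J. ?t x y u v i j)"
        unfolding sum_product by (simp add: sum_distrib_left mult_ac)
      finally show ?thesis .
    qed
    have "finite_rank_operator U V c y \<bullet> x = (\<Sum>u\<in>U. \<Sum>v\<in>V. \<Sum>i\<in>I. \<Sum>j\<in>J. ?t x y u v i j)"
      unfolding inner_finite_rank_operator by (intro sum.cong refl summand)
    also have "\<dots> = (\<Sum>i\<in>I. \<Sum>j\<in>J. \<Sum>u\<in>U. \<Sum>v\<in>V. ?t x y u v i j)"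
      by (rule trans[OF sum_swap_outer sum.cong[OF refl sum_swap_outer]])
    finally show ?thesis by (simp only: sum_distrib_right)
  qed
  then show ?thesis by (rule that)
qed

section \<open>Existence of a minimizer in kernel form\<close>

theorem proposition1:
  fixes K K\<beta> :: "real \<Rightarrow> real \<Rightarrow> real"
    and ev :: "'h::{real_inner,complete_space} \<Rightarrow> real \<Rightarrow> real"
    and ev\<beta> :: "'g::{real_inner,complete_space} \<Rightarrow> real \<Rightarrow> real"
    and lam C\<^sub>A C\<^sub>\<beta> :: real
    and n\<^sub>1 n\<^sub>2 T :: nat
    and s r :: "nat \<Rightarrow> real"
    and X Y :: "nat \<Rightarrow> real \<Rightarrow> real"
    and Z :: "nat \<Rightarrow> real ^ 'p"
  assumes "continuous_on ({0..1} \<times> {0..1}) (\<lambda>(x, y). K x y)"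
    and "symmetric_kernel {0..1} K"
    and "nonneg_definite_kernel {0..1} K"
    and "continuous_on ({0..1} \<times> {0..1}) (\<lambda>(x, y). K\<beta> x y)"
    and "symmetric_kernel {0..1} K\<beta>"
    and "nonneg_definite_kernel {0..1} K\<beta>"
    and "is_rkhs {0..1} K ev"
    and "is_rkhs {0..1} K\<beta> ev\<beta>"
    and "lam > 0" and "C\<^sub>A > 0" and "C\<^sub>\<beta> > 0"
    and "n\<^sub>1 \<ge> 1" and "n\<^sub>2 \<ge> 1" and "T \<ge> 1"
    and "s 0 = 0" and "s ` {1..n\<^sub>1} \<subseteq> {0..1}" and "strict_mono_on {1..n\<^sub>1} s"
    and "r 0 = 0" and "r ` {1..n\<^sub>2} \<subseteq> {0..1}" and "strict_mono_on {1..n\<^sub>2} r"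
  shows "\<exists>(A::'h \<Rightarrow> 'h) (\<beta>::'p \<Rightarrow> 'g).
    is_arg_min
      (\<lambda>(A, \<beta>).
        1 / (real T * real n\<^sub>2) *
          (\<Sum>t=1..T. \<Sum>j=1..n\<^sub>2. weight n\<^sub>2 r j *
            (Y t (r j)
              - 1 / real n\<^sub>1 * (\<Sum>i=1..n\<^sub>1. weight n\<^sub>1 s i * bivariate {0..1} K ev A (r j) (s i) * X t (s i))
              - (\<chi> l. ev\<beta> (\<beta> l) (r j)) \<bullet> Z t)\<^sup>2)
        + lam * (\<Sum>l\<in>UNIV. empirical_norm n\<^sub>2 r (ev\<beta> (\<beta> l))))
      (\<lambda>(A, \<beta>). A \<in> constraint_A C\<^sub>A \<and> \<beta> \<in> constraint_beta C\<^sub>\<beta>)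
      (A, \<beta>)
    \<and> (\<exists>a :: nat \<Rightarrow> nat \<Rightarrow> real. \<forall>x\<in>{0..1}. \<forall>y\<in>{0..1}.
        bivariate {0..1} K ev A x y = (\<Sum>i=1..n\<^sub>1. \<Sum>j=1..n\<^sub>2. a i j * K x (r j) * K y (s i)))
    \<and> (\<exists>b :: 'p \<Rightarrow> nat \<Rightarrow> real. \<forall>l. \<forall>x\<in>{0..1}.
        ev\<beta> (\<beta> l) x = (\<Sum>j=1..n\<^sub>2. b l j * K\<beta> (r j) x))"
proof -
  let ?k = "kernel_section {0..1} K ev" and ?k\<beta> = "kernel_section {0..1} K\<beta> ev\<beta>"
  let ?R = "(\<lambda>j. ?k (r j)) ` {1..n\<^sub>2}" and ?S = "(\<lambda>i. ?k (s i)) ` {1..n\<^sub>1}"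
  let ?R\<beta> = "(\<lambda>j. ?k\<beta> (r j)) ` {1..n\<^sub>2}"
  define valA where "valA = (\<lambda>A (p, q). if p \<in> ?R \<and> q \<in> ?S then A q \<bullet> p else 0)"
  define valB where "valB = (\<lambda>(\<beta> :: 'p \<Rightarrow> 'g) (l, p). if p \<in> ?R\<beta> then \<beta> l \<bullet> p else 0)"
  \<comment> \<open>The objective as a function of the finitely many values on which it depends.\<close>
  define F where "F = (\<lambda>z :: ('h \<times> 'h \<Rightarrow> real) \<times> ('p \<times> 'g \<Rightarrow> real).
        1 / (real T * real n\<^sub>2) *
          (\<Sum>t=1..T. \<Sum>j=1..n\<^sub>2. weight n\<^sub>2 r j *
            (Y t (r j)
              - 1 / real n\<^sub>1 * (\<Sum>i=1..n\<^sub>1. weight n\<^sub>1 s i * fst z (?k (r j), ?k (s i)) * X t (s i))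
              - (\<Sum>l\<in>UNIV. snd z (l, ?k\<beta> (r j)) * Z t $ l))\<^sup>2)
        + lam * (\<Sum>l\<in>UNIV. sqrt (1 / real n\<^sub>2 * (\<Sum>j=1..n\<^sub>2. weight n\<^sub>2 r j * (snd z (l, ?k\<beta> (r j)))\<^sup>2))))"
  define obj where "obj = (\<lambda>(A :: 'h \<Rightarrow> 'h, \<beta> :: 'p \<Rightarrow> 'g).
        1 / (real T * real n\<^sub>2) *
          (\<Sum>t=1..T. \<Sum>j=1..n\<^sub>2. weight n\<^sub>2 r j *
            (Y t (r j)
              - 1 / real n\<^sub>1 * (\<Sum>i=1..n\<^sub>1. weight n\<^sub>1 s i * bivariate {0..1} K ev A (r j) (s i) * X t (s i))
              - (\<chi> l. ev\<beta> (\<beta> l) (r j)) \<bullet> Z t)\<^sup>2)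
        + lam * (\<Sum>l\<in>UNIV. empirical_norm n\<^sub>2 r (ev\<beta> (\<beta> l))))"
  have r01: "r j \<in> {0..1}" if "j \<in> {1..n\<^sub>2}" for j using assms(19) that by blast
  have s01: "s i \<in> {0..1}" if "i \<in> {1..n\<^sub>1}" for i using assms(16) that by blast
  have obj_eq: "obj (A, \<beta>) = F (valA A, valB \<beta>)" for A \<beta>
  proof -
    have A: "bivariate {0..1} K ev A (r j) (s i) = valA A (?k (r j), ?k (s i))"
      if "j \<in> {1..n\<^sub>2}" "i \<in> {1..n\<^sub>1}" for i j
      using that by (simp add: bivariate_def valA_def)
    have B: "ev\<beta> (\<beta> l) (r j) = valB \<beta> (l, ?k\<beta> (r j))" if "j \<in> {1..n\<^sub>2}" for l j
      using that kernel_section_reproducing(2)[OF assms(8) r01[OF that]] by (simp add: valB_def)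
    show ?thesis
      unfolding obj_def F_def case_prod_conv fst_conv snd_conv empirical_norm_def inner_vec_def
      by (intro arg_cong2[where f = "(+)"] arg_cong2[where f = "(*)"] arg_cong2[where f = "(-)"]
          arg_cong[where f = sqrt] arg_cong[where f = "\<lambda>x. x\<^sup>2"] sum.cong refl) (simp_all add: A B)
  qed
  have fin: "finite ?R" "finite ?S" by simp_all
  obtain U V where UV: "finite U" "U \<subseteq> span ?R" "finite V" "V \<subseteq> span ?S"
    and compA: "compact (valA ` (constraint_A C\<^sub>A \<inter> range (finite_rank_operator U V)))"
    and redA: "valA ` constraint_A C\<^sub>A \<subseteq> valA ` (constraint_A C\<^sub>A \<inter> range (finite_rank_operator U V))"
    by (rule operator_values_compact[OF fin less_imp_le[OF assms(10)], folded valA_def])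
  let ?\<A> = "constraint_A C\<^sub>A \<inter> range (finite_rank_operator U V)"
  let ?\<B> = "constraint_beta C\<^sub>\<beta> \<inter> {\<beta>. \<forall>l. \<beta> l \<in> span ?R\<beta>}"
  have compB: "compact (valB ` ?\<B>)" and redB: "valB ` constraint_beta C\<^sub>\<beta> \<subseteq> valB ` ?\<B>"
    unfolding valB_def by (rule vector_values_compact; simp)+
  have contF: "continuous_on (valA ` ?\<A> \<times> valB ` ?\<B>) F"
    unfolding F_def
    by (intro continuous_intros continuous_on_product_then_coordinatewise[where f = fst]
        continuous_on_product_then_coordinatewise[where f = snd])
  have "hs_norm_sq (finite_rank_operator {} {} (\<lambda>_. 0) :: 'h \<Rightarrow> 'h) \<le> ennreal 0"
    using hs_norm_sq_finite_rank_operator_le[of "{}" "{}" "\<lambda>_. 0"] by (simp add: orthonormal_def)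
  then have "(finite_rank_operator {} {} (\<lambda>_. 0) :: 'h \<Rightarrow> 'h) \<in> constraint_A C\<^sub>A"
    by (simp add: constraint_A_def compact_operator_finite_rank_operator)
  moreover have "(\<lambda>_. 0) \<in> constraint_beta C\<^sub>\<beta>"
    using assms(11) by (simp add: constraint_beta_def)
  ultimately have nonempty: "valA ` ?\<A> \<times> valB ` ?\<B> \<noteq> {}" using redA redB by blast
  obtain z where "z \<in> valA ` ?\<A> \<times> valB ` ?\<B>"
    and "\<And>z'. z' \<in> valA ` ?\<A> \<times> valB ` ?\<B> \<Longrightarrow> F z \<le> F z'"
    using continuous_attains_inf[OF compact_Times[OF compA compB] nonempty contF] by blast
  then obtain A \<beta> where A: "A \<in> ?\<A>" and \<beta>: "\<beta> \<in> ?\<B>"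
    and min: "\<And>z. z \<in> valA ` ?\<A> \<times> valB ` ?\<B> \<Longrightarrow> F (valA A, valB \<beta>) \<le> F z"
    by (auto elim!: SigmaE imageE)
  have arg_min: "is_arg_min obj (\<lambda>(A, \<beta>). A \<in> constraint_A C\<^sub>A \<and> \<beta> \<in> constraint_beta C\<^sub>\<beta>) (A, \<beta>)"
    unfolding is_arg_min_linorder
  proof (intro conjI allI impI)
    show "case (A, \<beta>) of (A, \<beta>) \<Rightarrow> A \<in> constraint_A C\<^sub>A \<and> \<beta> \<in> constraint_beta C\<^sub>\<beta>"
      using A \<beta> by simp
    fix z :: "('h \<Rightarrow> 'h) \<times> ('p \<Rightarrow> 'g)"
    assume z: "case z of (A, \<beta>) \<Rightarrow> A \<in> constraint_A C\<^sub>A \<and> \<beta> \<in> constraint_beta C\<^sub>\<beta>"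
    obtain A' \<beta>' where "z = (A', \<beta>')" by (cases z)
    with z redA redB show "obj (A, \<beta>) \<le> obj z"
      unfolding obj_eq by (auto simp: obj_eq intro!: min)
  qed
  obtain c where c: "A = finite_rank_operator U V c" using A by blast
  obtain a where a: "\<And>x y. A y \<bullet> x
      = (\<Sum>i=1..n\<^sub>1. \<Sum>j=1..n\<^sub>2. a i j * (?k (r j) \<bullet> x) * (?k (s i) \<bullet> y))"
    by (rule finite_rank_operator_kernel_form[where c = c,
        OF finite_atLeastAtMost UV(4) finite_atLeastAtMost UV(2), folded c]) (rule that)
  have formA: "bivariate {0..1} K ev A x y = (\<Sum>i=1..n\<^sub>1. \<Sum>j=1..n\<^sub>2. a i j * K x (r j) * K y (s i))"
    if xy: "x \<in> {0..1}" "y \<in> {0..1}" for x y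
    unfolding bivariate_def a
  proof (intro sum.cong refl)
    fix i j assume ij: "i \<in> {1..n\<^sub>1}" "j \<in> {1..n\<^sub>2}"
    have "K (r j) x = K x (r j)" "K (s i) y = K y (s i)"
      using assms(2) r01[OF ij(2)] s01[OF ij(1)] xy unfolding symmetric_kernel_def by blast+
    then show "a i j * (?k (r j) \<bullet> ?k x) * (?k (s i) \<bullet> ?k y) = a i j * K x (r j) * K y (s i)"
      using inner_kernel_sections[OF assms(7)] r01[OF ij(2)] s01[OF ij(1)] xy by simp
  qed
  have "\<exists>b. \<beta> l = (\<Sum>j=1..n\<^sub>2. b j *\<^sub>R ?k\<beta> (r j))" for l
    using span_image_coefficients[of "{1..n\<^sub>2}" "\<beta> l" "\<lambda>j. ?k\<beta> (r j)"] \<beta> by blast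
  then obtain b where b: "\<And>l. \<beta> l = (\<Sum>j=1..n\<^sub>2. b l j *\<^sub>R ?k\<beta> (r j))" by metis
  have formB: "ev\<beta> (\<beta> l) x = (\<Sum>j=1..n\<^sub>2. b l j * K\<beta> (r j) x)" if x: "x \<in> {0..1}" for l x
  proof -
    have "ev\<beta> (\<beta> l) x = \<beta> l \<bullet> ?k\<beta> x"
      using kernel_section_reproducing(2)[OF assms(8) x] by simp
    also have "\<dots> = (\<Sum>j=1..n\<^sub>2. b l j * (?k\<beta> (r j) \<bullet> ?k\<beta> x))"
      by (simp add: b inner_sum_left)
    also have "\<dots> = (\<Sum>j=1..n\<^sub>2. b l j * K\<beta> (r j) x)"
      by (intro sum.cong refl) (simp add: inner_kernel_sections[OF assms(8) r01 x])
    finally show ?thesis .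
  qed
  from arg_min[unfolded obj_def] formA formB show ?thesis by blast
qed

end
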